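(* Let $n\ge 1$ be an integer and let $S_n=X_1+\cdots+X_n$, where $X_1,\dots,X_n$ are independent symmetric real random variables with $|X_i|\le 1$ for all $i$. Let $x>0$ be real and put $k=\lceil x\rceil$. Then $$\mathbb{P}\{S_n= x\}\le \mathbb{P}\{W_m=k\},$$ where $$m=\begin{cases}\min\{n,k^2\}, & \text{if } n+k \text{ is even},\\ \min\{n-1,k^2\}, & \text{if } n+k \text{ is odd}.\end{cases}$$
   Context: A random variable $X$ is symmetric if $X$ and $-X$ have the same distribution. For an integer $m\ge 0$, $W_m=\varepsilon_1+\cdots+\varepsilon_m$ denotes a sum of $m$ independent Rademacher random variables, i.e. $\mathbb{P}\{\varepsilon_i=1\}=\mathbb{P}\{\varepsilon_i=-1\}=1/2$; in particular $W_0=0$. $\lceil x\rceil$ is the least integer that is at least $x$. *)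

theory Defs
  imports "HOL-Probability.Probability"
begin

definition symmetric_rv :: "'a measure \<Rightarrow> ('a \<Rightarrow> real) \<Rightarrow> bool" where
  "symmetric_rv M X \<longleftrightarrow>
     X \<in> borel_measurable M \<and> distr M borel X = distr M borel (\<lambda>\<omega>. - X \<omega>)"

definition rademacher_pmf :: "real pmf" where
  "rademacher_pmf = pmf_of_set {-1, 1}"

text \<open>
  The law of \<open>W\<^sub>m = \<epsilon>\<^sub>1 + \<dots> + \<epsilon>\<^sub>m\<close>, realised on the product space
  whose coordinates are independent Rademacher variables (the \<open>0\<close> given to
  \<^const>\<open>Pi_pmf\<close> is only the junk value outside the index set).
\<close>
definition rademacher_sum_pmf :: "nat \<Rightarrow> real pmf" where
  "rademacher_sum_pmf m =
     map_pmf (\<lambda>\<epsilon>. \<Sum>i=1..m. \<epsilon> i) (Pi_pmf {1..m} 0 (\<lambda>_. rademacher_pmf))"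

end

theory Submission
  imports Defs
begin

text \<open>
  By symmetry and independence, replacing some of the \<open>X\<^sub>i\<close> by \<open>-X\<^sub>i\<close> does not change the
  law of the sum. Averaging \<open>P{\<Sum> \<plusminus>X\<^sub>i = x}\<close> over all \<open>2\<^sup>n\<close> choices of signs therefore
  expresses \<open>P{S\<^sub>n = x}\<close> as the expectation of the proportion of sign patterns that solve
  \<open>\<Sum> \<plusminus>a\<^sub>i = x\<close> with \<open>a\<^sub>i = X\<^sub>i(\<omega>)\<close>, so that it suffices to bound this proportion for fixed
  real \<open>a\<^sub>i\<close> with \<open>\<bar>a\<^sub>i\<bar> \<le> 1\<close> (\<open>prob_symmetric_sum_le\<close>).

  For nonzero \<open>a\<^sub>i\<close> there are at most \<open>C(n, \<lceil>(n + k) / 2\<rceil>)\<close> solutions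
  (\<open>card_sign_solutions_le\<close>). When the \<open>a\<^sub>i\<close> are positive, the solutions, viewed as sets of
  plus signs, form an antichain any two members of which share at least \<open>k\<close> elements, and the
  bound is Milner's theorem on such families. Here it has a short direct proof by induction on
  \<open>n\<close>: dividing the whole equation by a coefficient of largest modulus keeps all moduli at most
  \<open>1\<close>, does not decrease \<open>\<bar>x\<bar>\<close>, and makes one coefficient equal to \<open>1\<close>. Fixing the sign of
  that coefficient changes \<open>x\<close> into \<open>x - 1\<close> or \<open>x + 1\<close>, hence \<open>k\<close> into exactly \<open>k - 1\<close> or
  \<open>k + 1\<close>, and Pascal's rule adds the two bounds up.

  Zero coefficients do not affect the proportion, so the final bound is the maximum of
  \<open>C(r, \<lceil>(r + k) / 2\<rceil>) / 2\<^sup>r\<close> over \<open>r \<le> n\<close>. If \<open>r + k\<close> is even, this is \<open>P{W\<^sub>r = k}\<close>; if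
  \<open>r + k\<close> is odd, the value for \<open>r - 1\<close> is at least as large. Comparing consecutive terms,
  \<open>P{W\<^sub>r = k}\<close> with \<open>r \<equiv> k\<close> modulo \<open>2\<close> increases up to \<open>r = k\<^sup>2\<close> and decreases
  afterwards. The maximum is therefore attained at the \<open>m\<close> of the theorem
  (\<open>milner_fraction_le_pmf\<close>).
\<close>

section \<open>Counting the signs that produce a given sum\<close>

text \<open>
  A choice of signs is encoded by the set of indices that carry a plus sign, so that the
  solutions are a finite family of subsets of the index set.
\<close>
definition sign_solutions :: "'i set \<Rightarrow> ('i \<Rightarrow> real) \<Rightarrow> real \<Rightarrow> 'i set set" where
  "sign_solutions I a x = {s. s \<subseteq> I \<and> (\<Sum>i\<in>I. if i \<in> s then a i else - a i) = x}"

lemma finite_sign_solutions: "finite I \<Longrightarrow> finite (sign_solutions I a x)"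
  by (rule finite_subset[of _ "Pow I"]) (auto simp: sign_solutions_def)

lemma sign_solutions_empty: "sign_solutions {} a x = (if x = 0 then {{}} else {})"
  by (auto simp: sign_solutions_def)

lemma card_sign_solutions_insert:
  assumes "finite I" "j \<notin> I"
  shows "card (sign_solutions (insert j I) a x)
    = card (sign_solutions I a (x - a j)) + card (sign_solutions I a (x + a j))"
proof -
  define S where "S s = (\<Sum>i\<in>I. if i \<in> s then a i else - a i)" for s
  have S_insert: "S (insert j s) = S s" for s
    unfolding S_def using assms by (intro sum.cong) auto
  have sum_insert: "(\<Sum>i\<in>insert j I. if i \<in> s then a i else - a i)
      = (if j \<in> s then a j else - a j) + S s" for s
    unfolding S_def using assms by simp
  have "{s. s \<subseteq> insert j I \<and> j \<in> s \<and> S s = x - a j} = insert j ` {s. s \<subseteq> I \<and> S s = x - a j}"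
  proof (intro subset_antisym subsetI)
    fix s assume "s \<in> {s. s \<subseteq> insert j I \<and> j \<in> s \<and> S s = x - a j}"
    then have "s = insert j (s - {j})" "s - {j} \<subseteq> I" "S (s - {j}) = x - a j"
      using S_insert[of "s - {j}"] by (auto simp: insert_absorb)
    then show "s \<in> insert j ` {s. s \<subseteq> I \<and> S s = x - a j}" by blast
  qed (auto simp: S_insert)
  moreover have "sign_solutions (insert j I) a x
      = {s. s \<subseteq> insert j I \<and> j \<in> s \<and> S s = x - a j} \<union> {s. s \<subseteq> I \<and> S s = x + a j}"
    unfolding sign_solutions_def sum_insert using assms(2) by (auto simp: algebra_simps)
  moreover have "sign_solutions I a y = {s. s \<subseteq> I \<and> S s = y}" for y
    by (simp add: sign_solutions_def S_def)
  ultimately have split: "sign_solutions (insert j I) a x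
      = insert j ` sign_solutions I a (x - a j) \<union> sign_solutions I a (x + a j)" by simp
  have subset: "sign_solutions I a y \<subseteq> Pow I" for y
    by (auto simp: sign_solutions_def)
  have "inj_on (insert j) (Pow I)"
    using assms(2) by (intro inj_onI) (metis PowD insert_ident subsetD)
  then have "inj_on (insert j) (sign_solutions I a (x - a j))"
    using subset by (rule inj_on_subset)
  moreover have "insert j ` sign_solutions I a (x - a j) \<inter> sign_solutions I a (x + a j) = {}"
    using subset assms(2) by blast
  ultimately show ?thesis
    unfolding split using finite_sign_solutions[OF assms(1)]
    by (subst card_Un_disjoint) (simp_all add: card_image)
qed

lemma sign_solutions_scale:
  assumes "c \<noteq> 0"
  shows "sign_solutions I (\<lambda>i. a i / c) (x / c) = sign_solutions I a x"
proof -
  have "(\<Sum>i\<in>I. if i \<in> s then a i / c else - (a i / c))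
      = (\<Sum>i\<in>I. if i \<in> s then a i else - a i) / c" for s
    by (subst sum_divide_distrib) (intro sum.cong, auto)
  then show ?thesis
    using assms by (simp add: sign_solutions_def)
qed

text \<open>
  For \<open>k \<ge> 1\<close> this is \<open>C(n, \<lceil>(n + k) / 2\<rceil>)\<close>, Milner's maximum size of an antichain of
  subsets of an \<open>n\<close>-element set any two of which meet in at least \<open>k\<close> points; for \<open>k = 0\<close> it
  is the Sperner bound.
\<close>
definition milner_number :: "nat \<Rightarrow> nat \<Rightarrow> nat" where
  "milner_number n k = n choose ((n + k + 1) div 2)"

lemma milner_number_antimono:
  assumes "k \<le> l"
  shows "milner_number n l \<le> milner_number n k"
proof (cases "(n + l + 1) div 2 \<le> n")
  case True
  with assms show ?thesis
    unfolding milner_number_def by (intro binomial_antimono) (auto intro: div_le_mono)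
qed (simp add: milner_number_def binomial_eq_0 not_le)

text \<open>
  Pascal's rule: both sides have the same parity of \<open>n + k\<close>, so the rounding in
  \<open>\<lceil>(n + k) / 2\<rceil>\<close> acts in the same way on all three terms.
\<close>
lemma milner_number_Suc_Suc:
  "milner_number (Suc n) (Suc k) = milner_number n k + milner_number n (Suc (Suc k))"
proof -
  have "(Suc n + Suc k + 1) div 2 = Suc ((n + k + 1) div 2)"
    and "(n + Suc (Suc k) + 1) div 2 = Suc ((n + k + 1) div 2)"
    by simp_all
  then show ?thesis by (simp add: milner_number_def)
qed

text \<open>
  The counterpart of the recursion at \<open>k = 0\<close>, where \<open>\<bar>x - 1\<bar>\<close> and \<open>\<bar>x + 1\<bar>\<close> are both equal
  to \<open>1\<close> for \<open>x = 0\<close>.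
\<close>
lemma milner_number_Suc_0: "2 * milner_number n 1 \<le> milner_number (Suc n) 0"
proof -
  have "milner_number n 1 = n choose Suc (n div 2)"
    and "milner_number (Suc n) 0 = (n choose (n div 2)) + (n choose Suc (n div 2))"
    by (simp_all add: milner_number_def)
  then show ?thesis using binomial_maximum[of n "Suc (n div 2)"] by simp
qed

text \<open>
  The induction works because a coefficient equal to \<open>1\<close> moves \<open>x\<close> by a full unit: one of
  \<open>\<bar>x - 1\<bar>\<close>, \<open>\<bar>x + 1\<bar>\<close> is \<open>\<bar>x\<bar> + 1\<close> and the other is at least \<open>\<bar>x\<bar> - 1\<close>, which matches the
  recursion of the Milner numbers. A coefficient below \<open>1\<close> need not push \<open>\<lceil>\<bar>x\<bar>\<rceil>\<close> up, and
  rescaling removes that obstacle.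

  The hypothesis \<open>k < \<bar>x\<bar> + 1\<close> says that \<open>k \<le> \<lceil>\<bar>x\<bar>\<rceil>\<close>. Stated as an inequality, for \<open>x\<close> of
  either sign, it survives rescaling, which may increase \<open>\<bar>x\<bar>\<close> or change its sign.
\<close>
lemma card_sign_solutions_le:
  assumes "finite I" "\<And>i. i \<in> I \<Longrightarrow> a i \<noteq> 0" "\<And>i. i \<in> I \<Longrightarrow> \<bar>a i\<bar> \<le> 1" "real k < \<bar>x\<bar> + 1"
  shows "card (sign_solutions I a x) \<le> milner_number (card I) k"
  using assms
proof (induction "card I" arbitrary: I a x k)
  case 0
  then have "I = {}" by simp
  show ?case
  proof (cases "x = 0")
    case True
    then have "k = 0" using "0.prems"(4) by simp
    then show ?thesis
      using \<open>I = {}\<close> by (simp add: sign_solutions_empty milner_number_def)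
  qed (simp add: \<open>I = {}\<close> sign_solutions_empty)
next
  case (Suc n)
  define M where "M = Max ((\<lambda>i. \<bar>a i\<bar>) ` I)"
  have "I \<noteq> {}" using Suc.hyps(2) by auto
  then have "M \<in> (\<lambda>i. \<bar>a i\<bar>) ` I"
    unfolding M_def using Suc.prems(1) by (intro Max_in) auto
  then obtain j where j: "j \<in> I" "M = \<bar>a j\<bar>" by auto
  have max_j: "\<bar>a i\<bar> \<le> \<bar>a j\<bar>" if "i \<in> I" for i
    using that Suc.prems(1) unfolding j(2)[symmetric] M_def by (intro Max_ge) auto
  \<comment> \<open>Dividing by the signed value \<open>a j\<close> rather than by \<open>\<bar>a j\<bar>\<close> turns that coefficient into \<open>1\<close>
    whatever its sign is.\<close>
  define J b y where "J = I - {j}" and "b = (\<lambda>i. a i / a j)" and "y = x / a j"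
  have J: "finite J" "j \<notin> J" "I = insert j J" "card J = n"
    using Suc.prems(1) Suc.hyps(2) j(1) by (auto simp: J_def)
  have aj: "a j \<noteq> 0" "\<bar>a j\<bar> \<le> 1" using Suc.prems j(1) by auto
  have bj: "b j = 1" using aj by (simp add: b_def)
  have "\<bar>x\<bar> \<le> \<bar>y\<bar>"
    using aj mult_left_le[of "\<bar>a j\<bar>" "\<bar>x\<bar>"] by (simp add: y_def abs_divide pos_le_divide_eq)
  then have ky: "real k < \<bar>y\<bar> + 1" using Suc.prems(4) by linarith
  have IH: "card (sign_solutions J b z) \<le> milner_number n l" if "real l < \<bar>z\<bar> + 1" for z l
  proof -
    have "card (sign_solutions J b z) \<le> milner_number (card J) l"
    proof (rule Suc.hyps(1))
      show "n = card J" using J(4) by simp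
      show "b i \<noteq> 0" if "i \<in> J" for i
        using that Suc.prems(2) aj by (auto simp: b_def J_def)
      show "\<bar>b i\<bar> \<le> 1" if "i \<in> J" for i
        using that max_j[of i] aj(1) by (simp add: b_def J_def abs_divide pos_divide_le_eq)
    qed (use J that in auto)
    then show ?thesis using J(4) by simp
  qed
  have count: "card (sign_solutions I a x)
      = card (sign_solutions J b (y - 1)) + card (sign_solutions J b (y + 1))"
  proof -
    have "sign_solutions I a x = sign_solutions (insert j J) b y"
      unfolding b_def y_def J(3)[symmetric] by (rule sign_solutions_scale[OF aj(1), symmetric])
    then show ?thesis
      using card_sign_solutions_insert[OF J(1,2), of b y] by (simp only: bj)
  qed
  have pos: "card (sign_solutions J b (y - 1)) + card (sign_solutions J b (y + 1))
      \<le> milner_number (Suc n) (Suc l)" if l: "real (Suc l) < \<bar>y\<bar> + 1" for l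
  proof (cases "y \<ge> 0")
    case True
    with l have "real l < \<bar>y - 1\<bar> + 1" "real (Suc (Suc l)) < \<bar>y + 1\<bar> + 1" by linarith+
    then show ?thesis
      unfolding milner_number_Suc_Suc by (intro add_mono IH)
  next
    case False
    with l have "real l < \<bar>y + 1\<bar> + 1" "real (Suc (Suc l)) < \<bar>y - 1\<bar> + 1" by linarith+
    then show ?thesis
      unfolding milner_number_Suc_Suc add.commute[of "card (sign_solutions J b (y - 1))"]
      by (intro add_mono IH)
  qed
  have "card (sign_solutions J b (y - 1)) + card (sign_solutions J b (y + 1))
      \<le> milner_number (Suc n) k"
  proof (cases k)
    case (Suc l)
    then show ?thesis using pos ky by simp
  next
    case 0
    show ?thesis
    proof (cases "y = 0")
      case True
      then show ?thesis
        using IH[of 1 "y - 1"] IH[of 1 "y + 1"] milner_number_Suc_0[of n] 0 by simp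
    next
      case False
      \<comment> \<open>For \<open>y \<noteq> 0\<close> even the stronger bound for \<open>k = 1\<close> is available.\<close>
      then have "card (sign_solutions J b (y - 1)) + card (sign_solutions J b (y + 1))
          \<le> milner_number (Suc n) (Suc 0)"
        by (intro pos) simp
      then show ?thesis
        using milner_number_antimono[of 0 "Suc 0" "Suc n"] 0 by simp
    qed
  qed
  then show ?case using count Suc.hyps(2) by simp
qed

lemma card_sign_solutions_zero_coefficients:
  assumes "finite Z" "finite J" "Z \<inter> J = {}" "\<And>i. i \<in> Z \<Longrightarrow> a i = 0"
  shows "card (sign_solutions (Z \<union> J) a x) = 2 ^ card Z * card (sign_solutions J a x)"
  using assms
proof (induction Z rule: finite_induct)
  case (insert j Z)
  then have "j \<notin> Z \<union> J" "a j = 0" by auto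
  then have "card (sign_solutions (insert j (Z \<union> J)) a x) = 2 * card (sign_solutions (Z \<union> J) a x)"
    using insert.hyps(1) insert.prems(1) by (subst card_sign_solutions_insert) simp_all
  moreover have "card (sign_solutions (Z \<union> J) a x) = 2 ^ card Z * card (sign_solutions J a x)"
    using insert.prems by (intro insert.IH) auto
  ultimately show ?case
    using insert.hyps by simp
qed simp

text \<open>
  A vanishing coefficient doubles both the number of solutions and the number of sign patterns,
  so the proportion is governed by the number \<open>r\<close> of nonzero coefficients.
\<close>
lemma sign_solutions_fraction_le:
  assumes "finite I" "\<And>i. i \<in> I \<Longrightarrow> \<bar>a i\<bar> \<le> 1" "real k < \<bar>x\<bar> + 1"
  obtains r where "r \<le> card I"
    "real (card (sign_solutions I a x)) / 2 ^ card I \<le> real (milner_number r k) / 2 ^ r"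
proof
  define Z J where "Z = {i\<in>I. a i = 0}" and "J = {i\<in>I. a i \<noteq> 0}"
  have ZJ: "finite Z" "finite J" "Z \<inter> J = {}" "I = Z \<union> J"
    using assms(1) by (auto simp: Z_def J_def)
  then have card: "card I = card Z + card J" by (simp add: card_Un_disjoint)
  show "card J \<le> card I" using card by simp
  have "card (sign_solutions J a x) \<le> milner_number (card J) k"
    using assms by (intro card_sign_solutions_le) (auto simp: J_def)
  moreover have "card (sign_solutions I a x) = 2 ^ card Z * card (sign_solutions J a x)"
    unfolding ZJ(4) using ZJ(1-3) by (rule card_sign_solutions_zero_coefficients) (simp add: Z_def)
  ultimately show "real (card (sign_solutions I a x)) / 2 ^ card I
      \<le> real (milner_number (card J) k) / 2 ^ card J"
    unfolding card by (simp add: power_add field_simps)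
qed

section \<open>The simple random walk at a fixed point\<close>

text \<open>
  A sum of \<open>m\<close> signs of which \<open>j\<close> are positive equals \<open>2 * j - m\<close>.
\<close>
lemma rademacher_sum_pmf_eq_binomial:
  "rademacher_sum_pmf m = map_pmf (\<lambda>j. 2 * real j - real m) (binomial_pmf m (1/2))"
proof -
  define f :: "bool \<Rightarrow> real" where "f = (\<lambda>b. if b then 1 else -1)"
  have "rademacher_pmf = map_pmf f (pmf_of_set UNIV)"
    unfolding rademacher_pmf_def
    by (subst map_pmf_of_set_inj) (auto simp: f_def UNIV_bool inj_on_def insert_commute)
  also have "pmf_of_set UNIV = bernoulli_pmf (1/2)"
    by (simp add: bernoulli_pmf_half_conv_pmf_of_set)
  finally have rad: "rademacher_pmf = map_pmf f (bernoulli_pmf (1/2))" .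
  \<comment> \<open>Outside \<open>{1..m}\<close> the product has the default value \<open>0\<close>, which is not an image under \<open>f\<close>;
    the default is first changed to \<open>-1 = f False\<close> to transport the product of Bernoulli laws.\<close>
  have "Pi_pmf {1..m} (-1) (\<lambda>_. rademacher_pmf)
      = map_pmf (\<lambda>h. f \<circ> h) (Pi_pmf {1..m} False (\<lambda>_. bernoulli_pmf (1/2)))"
    unfolding rad by (rule Pi_pmf_map) (auto simp: f_def)
  moreover have "Pi_pmf {1..m} 0 (\<lambda>_. rademacher_pmf)
      = map_pmf (\<lambda>h x. if x \<in> {1..m} then h x else 0) (Pi_pmf {1..m} (-1) (\<lambda>_. rademacher_pmf))"
    by (rule Pi_pmf_default_swap[symmetric]) simp
  ultimately have "rademacher_sum_pmf m
      = map_pmf (\<lambda>h. \<Sum>i=1..m. f (h i)) (Pi_pmf {1..m} False (\<lambda>_. bernoulli_pmf (1/2)))"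
    by (simp add: rademacher_sum_pmf_def pmf.map_comp o_def)
  also have "(\<lambda>h. \<Sum>i=1..m. f (h i)) = (\<lambda>h. 2 * real (card {i\<in>{1..m}. h i}) - real m)"
  proof
    fix h :: "nat \<Rightarrow> bool"
    have "(\<Sum>i=1..m. f (h i)) = (\<Sum>i=1..m. 2 * of_bool (h i) - 1)"
      by (intro sum.cong) (auto simp: f_def)
    also have "\<dots> = 2 * (\<Sum>i=1..m. of_bool (h i)) - real m"
      by (simp add: sum_subtractf sum_distrib_left)
    also have "(\<Sum>i=1..m. of_bool (h i)) = real (card {i\<in>{1..m}. h i})"
      by (simp add: of_bool_def sum.If_cases Int_def)
    finally show "(\<Sum>i=1..m. f (h i)) = 2 * real (card {i\<in>{1..m}. h i}) - real m" .
  qed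
  also have "map_pmf \<dots> (Pi_pmf {1..m} False (\<lambda>_. bernoulli_pmf (1/2)))
      = map_pmf (\<lambda>j. 2 * real j - real m) (binomial_pmf m (1/2))"
    by (subst binomial_pmf_altdef'[of "{1..m}" _ _ False]) (auto simp: pmf.map_comp o_def)
  finally show ?thesis .
qed

lemma pmf_rademacher_sum:
  assumes "even (m + k)"
  shows "pmf (rademacher_sum_pmf m) (real k) = real (milner_number m k) / 2 ^ m"
proof -
  define j where "j = (m + k + 1) div 2"
  have "2 * j = m + k" using assms by (auto simp: j_def elim: evenE)
  then have "real k = 2 * real j - real m" by linarith
  moreover have "inj (\<lambda>j. 2 * real j - real m)" by (auto simp: inj_def)
  ultimately have "pmf (rademacher_sum_pmf m) (real k) = pmf (binomial_pmf m (1/2)) j"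
    unfolding rademacher_sum_pmf_eq_binomial
    using pmf_map_inj'[of "\<lambda>j. 2 * real j - real m"] by simp
  also have "\<dots> = real (m choose j) / 2 ^ m"
  proof (cases "j \<le> m")
    case True
    then have "(1/2::real) ^ j * (1/2) ^ (m - j) = 1 / 2 ^ m"
      by (simp add: power_one_over flip: power_add)
    with True show ?thesis by (simp add: mult.assoc)
  qed (simp add: pmf_eq_0_set_pmf binomial_eq_0)
  finally show ?thesis by (simp add: milner_number_def j_def)
qed

text \<open>
  \<open>P{W\<^sub>r = k}\<close> for \<open>r = k + 2 * j\<close>, that is, after \<open>k + j\<close> steps up and \<open>j\<close> steps down. This
  parametrization runs through exactly those \<open>r\<close> for which the probability is positive.
\<close>
definition walk_prob :: "nat \<Rightarrow> nat \<Rightarrow> real" where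
  "walk_prob k j = real ((k + 2 * j) choose (k + j)) / 2 ^ (k + 2 * j)"

text \<open>
  The ratio of consecutive terms, cleared of denominators, from the absorption identities of
  binomial coefficients.
\<close>
lemma walk_prob_Suc:
  "walk_prob k (Suc j) * (4 * ((real k + real j + 1) * (real j + 1)))
    = walk_prob k j * ((real k + 2 * real j + 2) * (real k + 2 * real j + 1))"
proof -
  define N s where "N = k + 2 * j" and "s = k + j"
  have 1: "Suc s * (Suc (Suc N) choose Suc s) = Suc (Suc N) * (Suc N choose s)"
    by (rule Suc_times_binomial)
  have "(Suc N - s) * (Suc N choose s) = Suc N * (N choose s)"
    using binomial_absorb_comp[of "Suc N" s] by simp
  then have 2: "Suc j * (Suc N choose s) = Suc N * (N choose s)"
    by (simp add: N_def s_def)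
  have "Suc j * (Suc s * (Suc (Suc N) choose Suc s)) = Suc (Suc N) * (Suc N * (N choose s))"
    unfolding 1 2[symmetric] by (simp only: mult_ac)
  then have "real (Suc j * (Suc s * (Suc (Suc N) choose Suc s)))
      = real (Suc (Suc N) * (Suc N * (N choose s)))" by (rule arg_cong)
  then have "real (Suc (Suc N) choose Suc s) * ((real s + 1) * (real j + 1))
      = real (N choose s) * ((real N + 2) * (real N + 1))"
    by (simp only: of_nat_mult of_nat_Suc) (simp add: algebra_simps)
  then have step: "real (Suc (Suc N) choose Suc s) * ((real k + real j + 1) * (real j + 1))
      = real (N choose s) * ((real k + 2 * real j + 2) * (real k + 2 * real j + 1))"
    by (simp add: N_def s_def)
  have "walk_prob k (Suc j) = real (Suc (Suc N) choose Suc s) / (4 * 2 ^ N)"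
    by (simp add: walk_prob_def N_def s_def)
  moreover have "walk_prob k j = real (N choose s) / 2 ^ N"
    by (simp add: walk_prob_def N_def s_def)
  ultimately show ?thesis using step by (simp del: binomial_Suc_Suc)
qed

text \<open>
  With \<open>t = k + 2 * j + 2\<close> the ratio of consecutive terms is
  \<open>t * (t - 1) / (t\<^sup>2 - k\<^sup>2)\<close>, which is at least \<open>1\<close> exactly if \<open>t \<le> k\<^sup>2\<close>.
\<close>
lemma walk_prob_le_Suc_iff:
  "walk_prob k j \<le> walk_prob k (Suc j) \<longleftrightarrow> k + 2 * j + 2 \<le> k\<^sup>2"
proof -
  define A where "A = 4 * ((real k + real j + 1) * (real j + 1))"
  define B where "B = (real k + 2 * real j + 2) * (real k + 2 * real j + 1)"
  have "A > 0" by (simp add: A_def)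
  have pos: "walk_prob k j > 0" by (simp add: walk_prob_def)
  have BA: "B - A = (real k)\<^sup>2 - (real k + 2 * real j + 2)"
    by (simp add: A_def B_def algebra_simps power2_eq_square)
  have "walk_prob k j \<le> walk_prob k (Suc j) \<longleftrightarrow> walk_prob k j * A \<le> walk_prob k (Suc j) * A"
    using \<open>A > 0\<close> by simp
  also have "\<dots> \<longleftrightarrow> A \<le> B"
    using walk_prob_Suc[of k j] pos by (simp add: A_def B_def)
  also have "\<dots> \<longleftrightarrow> real (k + 2 * j + 2) \<le> real (k\<^sup>2)"
    using BA by auto
  finally show ?thesis unfolding of_nat_le_iff .
qed

text \<open>
  The index \<open>p\<close> corresponds to \<open>k\<^sup>2\<close> steps, where the unimodal sequence is largest.
\<close>
lemma walk_prob_max: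
  assumes "i \<le> N" and "k + 2 * p = k\<^sup>2"
  shows "walk_prob k i \<le> walk_prob k (min N p)"
proof (cases "i \<le> p")
  case True
  have "i \<le> min N p" using True assms(1) by simp
  moreover have "walk_prob k i \<le> walk_prob k l" if "i \<le> l" "l \<le> p" for l
    using that
  proof (induction l rule: dec_induct)
    case (step l)
    then have "walk_prob k l \<le> walk_prob k (Suc l)"
      using assms(2) by (subst walk_prob_le_Suc_iff) linarith
    with step show ?case by simp
  qed simp
  ultimately show ?thesis by simp
next
  case False
  then have "p \<le> i" by simp
  then have "walk_prob k i \<le> walk_prob k p"
  proof (induction i rule: dec_induct)
    case (step l)
    then have "\<not> walk_prob k l \<le> walk_prob k (Suc l)"
      using assms(2) by (subst walk_prob_le_Suc_iff) linarith
    with step show ?case by simp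
  qed simp
  moreover have "min N p = p" using False assms(1) by simp
  ultimately show ?thesis by simp
qed

lemma milner_fraction_eq_walk_prob:
  "real (milner_number (k + 2 * j) k) / 2 ^ (k + 2 * j) = walk_prob k j"
proof -
  have "(k + 2 * j + k + 1) div 2 = k + j" by simp
  then show ?thesis by (simp add: milner_number_def walk_prob_def)
qed

text \<open>
  Passing from \<open>r\<close> to \<open>r + 1\<close> in the odd case doubles the denominator, whereas the new
  coefficient is the sum of two neighbours in row \<open>r\<close>, the larger of which is the old one.
\<close>
lemma milner_fraction_odd:
  assumes "odd (Suc r + k)"
  shows "real (milner_number (Suc r) k) / 2 ^ Suc r \<le> real (milner_number r k) / 2 ^ r"
proof -
  define h where "h = (r + k) div 2"
  have "(Suc r + k + 1) div 2 = Suc h" "(r + k + 1) div 2 = h" "r div 2 \<le> h"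
    using assms by (auto simp: h_def elim!: evenE)
  moreover have "(r choose Suc h) \<le> (r choose h)"
  proof (cases "Suc h \<le> r")
    case True
    with \<open>r div 2 \<le> h\<close> show ?thesis by (intro binomial_antimono) auto
  qed (simp add: binomial_eq_0)
  ultimately have "milner_number (Suc r) k \<le> 2 * milner_number r k"
    unfolding milner_number_def by simp
  then have "real (milner_number (Suc r) k) \<le> 2 * real (milner_number r k)"
    by linarith
  then show ?thesis by (simp add: field_simps)
qed

text \<open>
  The maximization over \<open>r\<close>: parity reduces it to \<open>r \<equiv> k\<close> modulo \<open>2\<close>, where the largest
  admissible value is \<open>n\<close> or \<open>n - 1\<close>, and unimodality with its peak at \<open>k\<^sup>2\<close> does the rest.
\<close>
lemma milner_fraction_le_pmf:
  assumes "r \<le> n" "k \<ge> 1"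
    and m: "m = (if even (n + k) then min n (k\<^sup>2) else min (n - 1) (k\<^sup>2))"
  shows "real (milner_number r k) / 2 ^ r \<le> pmf (rademacher_sum_pmf m) (real k)"
proof -
  define N where "N = (if even (n + k) then n else n - 1)"
  have "even (k\<^sup>2 - k)" "k \<le> k\<^sup>2"
    using assms(2) by (auto simp: power2_eq_square)
  then obtain p where p: "k + 2 * p = k\<^sup>2"
    by (metis dvdE le_add_diff_inverse)
  have mN: "m = min N (k\<^sup>2)" by (simp add: m N_def)
  have even_case: "real (milner_number r k) / 2 ^ r \<le> pmf (rademacher_sum_pmf m) (real k)"
    if r: "r \<le> N" "even (r + k)" for r
  proof (cases "r < k")
    case True
    then have "(r + k + 1) div 2 > r" by linarith
    then show ?thesis by (simp add: milner_number_def binomial_eq_0)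
  next
    case False
    then have "even (r - k)" "k \<le> r" using r(2) by auto
    then obtain i where i: "r = k + 2 * i" by (metis dvdE le_add_diff_inverse)
    have "n \<ge> 1" using i r(1) assms(2) by (auto simp: N_def split: if_splits)
    then have "even (N + k)" by (auto simp: N_def)
    then have "even (N - k)" "k \<le> N" using i r(1) by auto
    then obtain q where q: "N = k + 2 * q" by (metis dvdE le_add_diff_inverse)
    have mq: "m = k + 2 * min q p" using mN q p by (auto simp: min_def)
    have "walk_prob k i \<le> walk_prob k (min q p)"
      using i q r(1) p by (intro walk_prob_max) auto
    also have "\<dots> = pmf (rademacher_sum_pmf m) (real k)"
      using pmf_rademacher_sum[of m k] milner_fraction_eq_walk_prob[of k "min q p"]
      by (simp add: mq)
    finally show ?thesis using milner_fraction_eq_walk_prob[of k i] by (simp add: i)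
  qed
  show ?thesis
  proof (cases "even (r + k)")
    case True
    then have "r \<le> N" using assms(1) by (cases "r = n") (auto simp: N_def)
    with True show ?thesis by (intro even_case)
  next
    case False
    show ?thesis
    proof (cases r)
      case 0
      then show ?thesis using assms(2) by (simp add: milner_number_def binomial_eq_0)
    next
      case (Suc r')
      then have "r' \<le> N" "even (r' + k)" using False assms(1) by (auto simp: N_def)
      then show ?thesis
        using even_case[of r'] milner_fraction_odd[of r' k] False Suc by simp
    qed
  qed
qed

section \<open>Symmetrization\<close>

text \<open>
  Under independence the marginal laws determine the joint law as their product, and hence the
  law of the sum.
\<close>
lemma (in prob_space) distr_sum_indep_cong:
  fixes X Y :: "'i \<Rightarrow> 'a \<Rightarrow> real"
  assumes "finite I"
    and X: "indep_vars (\<lambda>_. borel) X I" and Y: "indep_vars (\<lambda>_. borel) Y I"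
    and eq: "\<And>i. i \<in> I \<Longrightarrow> distr M borel (X i) = distr M borel (Y i)"
  shows "distr M borel (\<lambda>\<omega>. \<Sum>i\<in>I. X i \<omega>) = distr M borel (\<lambda>\<omega>. \<Sum>i\<in>I. Y i \<omega>)"
proof (cases "I = {}")
  case False
  let ?P = "\<Pi>\<^sub>M i\<in>I. (borel :: real measure)"
  have rvX: "random_variable borel (X i)" and rvY: "random_variable borel (Y i)" if "i \<in> I" for i
    using that X Y by (auto simp: indep_vars_def)
  have "distr M ?P (\<lambda>\<omega>. \<lambda>i\<in>I. X i \<omega>) = (\<Pi>\<^sub>M i\<in>I. distr M borel (X i))"
    using indep_vars_iff_distr_eq_PiM'[where M'="\<lambda>_. borel" and X=X and I=I] False rvX X by simp
  also have "\<dots> = (\<Pi>\<^sub>M i\<in>I. distr M borel (Y i))"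
    by (intro PiM_cong eq refl)
  also have "\<dots> = distr M ?P (\<lambda>\<omega>. \<lambda>i\<in>I. Y i \<omega>)"
    using indep_vars_iff_distr_eq_PiM'[where M'="\<lambda>_. borel" and X=Y and I=I] False rvY Y by simp
  finally have joint: "distr M ?P (\<lambda>\<omega>. \<lambda>i\<in>I. X i \<omega>) = distr M ?P (\<lambda>\<omega>. \<lambda>i\<in>I. Y i \<omega>)" .
  have push: "distr M borel (\<lambda>\<omega>. \<Sum>i\<in>I. Z i \<omega>)
      = distr (distr M ?P (\<lambda>\<omega>. \<lambda>i\<in>I. Z i \<omega>)) borel (\<lambda>v. \<Sum>i\<in>I. v i)"
    if [measurable]: "\<And>i. i \<in> I \<Longrightarrow> random_variable borel (Z i)" for Z
    by (subst distr_distr) (auto simp: o_def intro!: measurable_restrict that distr_cong sum.cong)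
  show ?thesis using push[of X] push[of Y] rvX rvY joint by simp
qed simp

text \<open>
  Every event \<open>E s\<close>, in which the variables outside \<open>s\<close> are negated, has the same probability
  as the event in question. The sum of the indicators of these \<open>2\<^sup>n\<close> events at \<open>\<omega>\<close> is the
  number of sign solutions with coefficients \<open>X\<^sub>i(\<omega>)\<close>.
\<close>
lemma (in prob_space) prob_symmetric_sum_le:
  fixes X :: "'i \<Rightarrow> 'a \<Rightarrow> real"
  assumes I: "finite I"
    and indep: "indep_vars (\<lambda>_. borel) X I"
    and sym: "\<And>i. i \<in> I \<Longrightarrow> symmetric_rv M (X i)"
    and bound: "AE \<omega> in M. real (card (sign_solutions I (\<lambda>i. X i \<omega>) x)) / 2 ^ card I \<le> B"
  shows "prob {\<omega> \<in> space M. (\<Sum>i\<in>I. X i \<omega>) = x} \<le> B"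
proof -
  define E where "E s = {\<omega> \<in> space M. (\<Sum>i\<in>I. if i \<in> s then X i \<omega> else - X i \<omega>) = x}" for s
  have rv [measurable]: "random_variable borel (X i)" if "i \<in> I" for i
    using sym[OF that] by (simp add: symmetric_rv_def)
  have meas: "(\<lambda>\<omega>. if i \<in> s then X i \<omega> else - X i \<omega>) \<in> borel_measurable M" if "i \<in> I" for i s
    using rv[OF that] by simp
  have meas_sum: "(\<lambda>\<omega>. \<Sum>i\<in>I. if i \<in> s then X i \<omega> else - X i \<omega>) \<in> borel_measurable M" for s
    by (intro borel_measurable_sum meas)
  have E_sets: "E s \<in> events" for s
    unfolding E_def using meas_sum by measurable
  have as_distr: "prob {\<omega> \<in> space M. Z \<omega> = x} = measure (distr M borel Z) {x}"
    if "Z \<in> borel_measurable M" for Z :: "'a \<Rightarrow> real"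
    using that by (subst measure_distr) (auto intro!: arg_cong[where f=prob])
  have E_prob: "prob (E s) = prob {\<omega> \<in> space M. (\<Sum>i\<in>I. X i \<omega>) = x}" for s
  proof -
    have "indep_vars (\<lambda>_. borel) (\<lambda>i \<omega>. (if i \<in> s then id else uminus) (X i \<omega>)) I"
      by (rule indep_vars_compose2[OF indep]) auto
    also have "(\<lambda>i \<omega>. (if i \<in> s then id else uminus) (X i \<omega>))
        = (\<lambda>i \<omega>. if i \<in> s then X i \<omega> else - X i \<omega>)" by (auto simp: fun_eq_iff)
    finally have "distr M borel (\<lambda>\<omega>. \<Sum>i\<in>I. if i \<in> s then X i \<omega> else - X i \<omega>)
        = distr M borel (\<lambda>\<omega>. \<Sum>i\<in>I. X i \<omega>)"
    proof (intro distr_sum_indep_cong I indep)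
      show "distr M borel (\<lambda>\<omega>. if i \<in> s then X i \<omega> else - X i \<omega>) = distr M borel (X i)"
        if "i \<in> I" for i
        using sym[OF that] by (cases "i \<in> s") (simp_all add: symmetric_rv_def)
    qed
    then show ?thesis
      unfolding E_def using as_distr[OF meas_sum[of s]]
        as_distr[OF borel_measurable_sum[of I X M, OF rv]] by simp
  qed
  have count: "(\<Sum>s\<in>Pow I. indicator (E s) \<omega>) = real (card (sign_solutions I (\<lambda>i. X i \<omega>) x))"
    if "\<omega> \<in> space M" for \<omega>
  proof -
    have "(\<Sum>s\<in>Pow I. indicator (E s) \<omega>)
        = (\<Sum>s\<in>Pow I. if s \<in> sign_solutions I (\<lambda>i. X i \<omega>) x then 1 else (0::real))"
      using that by (intro sum.cong) (auto simp: E_def sign_solutions_def indicator_def)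
    also have "\<dots> = real (card (Pow I \<inter> sign_solutions I (\<lambda>i. X i \<omega>) x))"
      using I by (simp add: sum.If_cases)
    also have "Pow I \<inter> sign_solutions I (\<lambda>i. X i \<omega>) x = sign_solutions I (\<lambda>i. X i \<omega>) x"
      by (auto simp: sign_solutions_def)
    finally show ?thesis .
  qed
  have int: "integrable M (\<lambda>\<omega>. indicator (E s) \<omega> :: real)" for s
    using E_sets by (simp add: emeasure_eq_measure)
  have "2 ^ card I * prob {\<omega> \<in> space M. (\<Sum>i\<in>I. X i \<omega>) = x} = (\<Sum>s\<in>Pow I. prob (E s))"
    using I by (simp add: E_prob card_Pow)
  also have "\<dots> = (\<Sum>s\<in>Pow I. \<integral>\<omega>. indicator (E s) \<omega> \<partial>M)"
    using E_sets by simp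
  also have "\<dots> = (\<integral>\<omega>. (\<Sum>s\<in>Pow I. indicator (E s) \<omega>) \<partial>M)"
    by (rule Bochner_Integration.integral_sum[symmetric]) (rule int)
  also have "\<dots> \<le> 2 ^ card I * B"
  proof (rule integral_le_const)
    show "integrable M (\<lambda>\<omega>. \<Sum>s\<in>Pow I. indicator (E s) \<omega> :: real)"
      by (intro Bochner_Integration.integrable_sum int)
    show "AE \<omega> in M. (\<Sum>s\<in>Pow I. indicator (E s) \<omega>) \<le> 2 ^ card I * B"
      using bound AE_space by eventually_elim (simp add: count field_simps)
  qed
  finally show ?thesis by simp
qed

theorem theorem1p2:
  fixes M :: "'a measure" and X :: "nat \<Rightarrow> 'a \<Rightarrow> real"
    and n k m :: nat and x :: real
  assumes "prob_space M"
    and "n \<ge> 1"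
    and "prob_space.indep_vars M (\<lambda>_. borel) X {1..n}"
    and "\<And>i. i \<in> {1..n} \<Longrightarrow> symmetric_rv M (X i)"
    and "\<And>i. i \<in> {1..n} \<Longrightarrow> AE \<omega> in M. \<bar>X i \<omega>\<bar> \<le> 1"
    and "x > 0"
    and "int k = \<lceil>x\<rceil>"
    and "m = (if even (n + k) then min n (k^2) else min (n - 1) (k^2))"
  shows "measure M {\<omega> \<in> space M. (\<Sum>i=1..n. X i \<omega>) = x}
           \<le> pmf (rademacher_sum_pmf m) (real k)"
proof -
  interpret prob_space M by fact
  have k: "k \<ge> 1" "real k < \<bar>x\<bar> + 1"
    using assms(6,7) by linarith+
  have "AE \<omega> in M. \<forall>i\<in>{1..n}. \<bar>X i \<omega>\<bar> \<le> 1"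
    using assms(5) by (intro AE_finite_allI) auto
  then have bound: "AE \<omega> in M. real (card (sign_solutions {1..n} (\<lambda>i. X i \<omega>) x)) / 2 ^ card {1..n}
      \<le> pmf (rademacher_sum_pmf m) (real k)"
  proof eventually_elim
    case (elim \<omega>)
    obtain r where "r \<le> card {1..n}"
      "real (card (sign_solutions {1..n} (\<lambda>i. X i \<omega>) x)) / 2 ^ card {1..n}
        \<le> real (milner_number r k) / 2 ^ r"
      using sign_solutions_fraction_le[of "{1..n}" "\<lambda>i. X i \<omega>" k x] elim k(2) by auto
    with milner_fraction_le_pmf[of r n k m] k(1) assms(8) show ?case by simp
  qed
  show ?thesis
    by (rule prob_symmetric_sum_le[OF _ assms(3,4) bound]) auto
qed

end
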